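(* For $\alpha\ge 0$, $\beta,\theta>0$ let $K_{\alpha,\beta,\theta}$ be the distribution function $$K_{\alpha,\beta,\theta}(x)=1-\frac{1}{\left(\frac{x}{\beta}+\alpha^\theta\right)^{1/\theta}+1-\alpha},\qquad x\ge 0.$$ Let $\alpha,\beta,\theta>0$ and $\alpha_1,\beta_1,\theta_1>0$ satisfy all of the following: (HR1) (i) $\beta\theta\alpha^{\theta-1}\le\beta_1\theta_1\alpha_1^{\theta_1-1}$ and (ii) $\beta\theta\alpha^{\theta}\le\beta_1\theta_1\alpha_1^{\theta_1}$; (HR2) $\theta<\theta_1$; (HR3) $(1-\alpha_1)(\theta_1-1)\ge 0$; (HR4) $\left(\frac1\alpha-1\right)(\theta-1)\le\left(\frac1{\alpha_1}-1\right)(\theta_1-1)$. Then $K_{\alpha,\beta,\theta}\leq_{hr}K_{\alpha_1,\beta_1,\theta_1}$.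
   Context: The hazard rate of $K_{\alpha,\beta,\theta}$ is $h_{\alpha,\beta,\theta}(x)=\dfrac{K_{\alpha,\beta,\theta}'(x)}{1-K_{\alpha,\beta,\theta}(x)}=\dfrac{\left(\frac{x}{\beta}+\alpha^\theta\right)^{\frac1\theta-1}}{\beta\theta\left(\left(\frac{x}{\beta}+\alpha^\theta\right)^{\frac1\theta}+1-\alpha\right)}$ for $x\ge 0$. The hazard rate order $K_{\alpha,\beta,\theta}\leq_{hr}K_{\alpha_1,\beta_1,\theta_1}$ means $h_{\alpha,\beta,\theta}(x)\ge h_{\alpha_1,\beta_1,\theta_1}(x)$ for every $x\ge 0$. *)

theory Defs
  imports "HOL-Analysis.Analysis"
begin

definition K_dist :: "real \<Rightarrow> real \<Rightarrow> real \<Rightarrow> real \<Rightarrow> real" where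
  "K_dist \<alpha> \<beta> \<theta> x =
     (if x < 0 then 0
      else 1 - 1 / ((x / \<beta> + \<alpha> powr \<theta>) powr (1 / \<theta>) + 1 - \<alpha>))"

text \<open>
  The derivative is taken within the half-line on which the hazard rate is considered. For
  \<open>x > 0\<close> this is the ordinary derivative; at \<open>x = 0\<close>, where the distribution function
  has a kink, it is the right derivative.
\<close>

definition hazard_rate :: "(real \<Rightarrow> real) \<Rightarrow> real \<Rightarrow> real" where
  "hazard_rate F x = vector_derivative F (at x within {0..}) / (1 - F x)"

definition hr_le :: "(real \<Rightarrow> real) \<Rightarrow> (real \<Rightarrow> real) \<Rightarrow> bool"  (infix "\<le>\<^sub>h\<^sub>r" 50) where
  "F \<le>\<^sub>h\<^sub>r G \<longleftrightarrow> (\<forall>x\<ge>0. hazard_rate F x \<ge> hazard_rate G x)"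

lemma hazard_rate_K_dist:
  fixes \<alpha> \<beta> \<theta> x :: real
  assumes "\<alpha> > 0" "\<beta> > 0" "\<theta> > 0" "x \<ge> 0"
  shows "hazard_rate (K_dist \<alpha> \<beta> \<theta>) x =
           (x / \<beta> + \<alpha> powr \<theta>) powr (1 / \<theta> - 1) /
           (\<beta> * \<theta> * ((x / \<beta> + \<alpha> powr \<theta>) powr (1 / \<theta>) + 1 - \<alpha>))"
proof -
  define u where "u = x / \<beta> + \<alpha> powr \<theta>"
  define D where "D = u powr (1 / \<theta>) + 1 - \<alpha>"
  have u: "u > 0" using assms by (simp add: u_def add_nonneg_pos)
  have "(\<alpha> powr \<theta>) powr (1 / \<theta>) \<le> u powr (1 / \<theta>)"
    using assms by (intro powr_mono2) (simp_all add: u_def)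
  then have D: "D > 0" using assms by (simp add: D_def powr_powr)
  let ?F = "\<lambda>y. 1 - 1 / ((y / \<beta> + \<alpha> powr \<theta>) powr (1 / \<theta>) + 1 - \<alpha>)"
  have "(?F has_real_derivative ((1 / \<theta>) * u powr (1 / \<theta> - 1) * (1 / \<beta>)) / D\<^sup>2)
          (at x within {0..})"
    using u D assms unfolding u_def D_def
    by (auto intro!: derivative_eq_intros simp: power2_eq_square)
  then have "(K_dist \<alpha> \<beta> \<theta> has_real_derivative
          ((1 / \<theta>) * u powr (1 / \<theta> - 1) * (1 / \<beta>)) / D\<^sup>2) (at x within {0..})"
    by (rule has_field_derivative_transform_within[where d = 1])
       (use assms in \<open>auto simp: K_dist_def\<close>)
  moreover have nontriv: "at x within {0..} \<noteq> bot"
  proof -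
    have "at_right x \<le> at x within {0..}"
      using assms by (intro at_le) auto
    then show ?thesis
      using trivial_limit_at_right_real[of x] by (metis bot.extremum_unique)
  qed
  ultimately have "vector_derivative (K_dist \<alpha> \<beta> \<theta>) (at x within {0..}) =
          ((1 / \<theta>) * u powr (1 / \<theta> - 1) * (1 / \<beta>)) / D\<^sup>2"
    using assms nontriv
    by (intro vector_derivative_within)
       (auto simp: has_real_derivative_iff_has_vector_derivative)
  moreover have "1 - K_dist \<alpha> \<beta> \<theta> x = 1 / D"
    using assms by (simp add: K_dist_def D_def u_def)
  ultimately have "hazard_rate (K_dist \<alpha> \<beta> \<theta>) x =
      (((1 / \<theta>) * u powr (1 / \<theta> - 1) * (1 / \<beta>)) / D\<^sup>2) / (1 / D)"
    unfolding hazard_rate_def by (simp only:)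
  also have "\<dots> = u powr (1 / \<theta> - 1) / (\<beta> * \<theta> * D)"
    using D assms by (simp add: power2_eq_square)
  finally show ?thesis
    unfolding u_def D_def .
qed

end

(*
  The reciprocal of the hazard rate is
    g(x) = \<beta> \<theta> (u + (1 - \<alpha>) u^(1 - 1/\<theta>)),   u = x/\<beta> + \<alpha>^\<theta>.
  Condition (HR1)(i) says g(0) \<le> g1(0), so it suffices to compare derivatives:
    g'(x) = \<theta> + (1/\<alpha> - 1) (\<theta> - 1) (1 + x / (\<beta> \<alpha>^\<theta>))^(-1/\<theta>).
  (HR2) compares the constant terms and (HR4) the coefficients of the power factors; the
  larger coefficient is nonnegative by (HR3). The power factors are compared by (HR1)(ii)
  and the fact that \<theta> |-> (1 + \<theta> t)^(1/\<theta>) is decreasing.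
*)
theory Submission
  imports Defs
begin

text \<open>The reciprocal turns the quotient into a sum of two powers of an affine function of
  \<open>x\<close>, which is easy to differentiate.\<close>

definition recip_hazard :: "real \<Rightarrow> real \<Rightarrow> real \<Rightarrow> real \<Rightarrow> real" where
  "recip_hazard \<alpha> \<beta> \<theta> x = \<beta> * \<theta> *
     ((x / \<beta> + \<alpha> powr \<theta>) + (1 - \<alpha>) * (x / \<beta> + \<alpha> powr \<theta>) powr (1 - 1 / \<theta>))"

text \<open>Factoring out \<open>u powr (1 - 1 / \<theta>)\<close> leaves
  \<open>u powr (1 / \<theta>) + 1 - \<alpha>\<close>, the reciprocal of the survival function. It
  is at least 1, because \<open>u \<ge> \<alpha> powr \<theta>\<close> for
  \<open>x \<ge> 0\<close>.\<close>

lemma recip_hazard_pos: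
  assumes "\<alpha> > 0" "\<beta> > 0" "\<theta> > 0" "x \<ge> 0"
  shows "recip_hazard \<alpha> \<beta> \<theta> x > 0"
    and hazard_rate_eq_inverse_recip_hazard:
      "hazard_rate (K_dist \<alpha> \<beta> \<theta>) x = inverse (recip_hazard \<alpha> \<beta> \<theta> x)"
proof -
  define u where "u = x / \<beta> + \<alpha> powr \<theta>"
  have u: "u > 0" using assms by (simp add: u_def add_nonneg_pos)
  have "(\<alpha> powr \<theta>) powr (1 / \<theta>) \<le> u powr (1 / \<theta>)"
    using assms by (intro powr_mono2) (simp_all add: u_def)
  then have D: "u powr (1 / \<theta>) + 1 - \<alpha> > 0" using assms by (simp add: powr_powr)
  have "u powr (1 - 1 / \<theta>) * u powr (1 / \<theta>) = u"
    using u by (simp flip: powr_add)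
  then have eq: "recip_hazard \<alpha> \<beta> \<theta> x =
      \<beta> * \<theta> * (u powr (1 - 1 / \<theta>) * (u powr (1 / \<theta>) + 1 - \<alpha>))"
    unfolding recip_hazard_def u_def[symmetric] by (simp add: algebra_simps)
  show "recip_hazard \<alpha> \<beta> \<theta> x > 0"
    unfolding eq using u D assms by simp
  have "u powr (1 / \<theta> - 1) = inverse (u powr (1 - 1 / \<theta>))"
    by (simp flip: powr_minus)
  then show "hazard_rate (K_dist \<alpha> \<beta> \<theta>) x = inverse (recip_hazard \<alpha> \<beta> \<theta> x)"
    unfolding eq using hazard_rate_K_dist[OF assms] by (simp add: u_def field_simps)
qed

text \<open>The two terms \<open>\<alpha> powr \<theta>\<close> cancel. What remains is the quantity
  compared in \<open>HR1_i\<close>.\<close>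

lemma recip_hazard_0:
  assumes "\<alpha> > 0" "\<theta> > 0"
  shows "recip_hazard \<alpha> \<beta> \<theta> 0 = \<beta> * \<theta> * \<alpha> powr (\<theta> - 1)"
proof -
  have "(\<alpha> powr \<theta>) powr (1 - 1 / \<theta>) = \<alpha> powr (\<theta> - 1)"
    using assms by (simp add: powr_powr right_diff_distrib)
  moreover have "\<alpha> powr \<theta> = \<alpha> * \<alpha> powr (\<theta> - 1)"
    using assms by (simp add: powr_mult_base)
  ultimately show ?thesis by (simp add: recip_hazard_def algebra_simps)
qed

text \<open>The derivative is two-sided even at \<open>x = 0\<close>, since the base of the power is
  still positive there.\<close>

lemma has_real_derivative_recip_hazard:
  assumes "\<alpha> > 0" "\<beta> > 0" "\<theta> > 0" "x \<ge> 0"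
  shows "(recip_hazard \<alpha> \<beta> \<theta> has_real_derivative
    \<theta> + (1 / \<alpha> - 1) * (\<theta> - 1) * (1 + x / (\<beta> * \<alpha> powr \<theta>)) powr (- (1 / \<theta>))) (at x)"
proof -
  define u where "u = x / \<beta> + \<alpha> powr \<theta>"
  have u: "u > 0" using assms by (simp add: u_def add_nonneg_pos)
  \<comment> \<open>Extracting \<open>\<alpha> powr \<theta>\<close> normalises the power factor to
    1 at \<open>x = 0\<close> and moves \<open>1 / \<alpha>\<close> into the coefficient, which
    thereby takes the form used in \<open>HR4\<close>.\<close>
  have "u = \<alpha> powr \<theta> * (1 + x / (\<beta> * \<alpha> powr \<theta>))"
    using assms by (simp add: u_def field_simps)
  then have "u powr (- (1 / \<theta>)) =
      (\<alpha> powr \<theta>) powr (- (1 / \<theta>)) * (1 + x / (\<beta> * \<alpha> powr \<theta>)) powr (- (1 / \<theta>))"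
    using assms by (simp add: powr_mult)
  also have "(\<alpha> powr \<theta>) powr (- (1 / \<theta>)) = 1 / \<alpha>"
    using assms by (simp add: powr_powr powr_minus divide_inverse)
  finally have v: "u powr (- (1 / \<theta>)) =
      1 / \<alpha> * (1 + x / (\<beta> * \<alpha> powr \<theta>)) powr (- (1 / \<theta>))" .
  have "(recip_hazard \<alpha> \<beta> \<theta> has_real_derivative
      \<beta> * \<theta> * (1 / \<beta> + (1 - \<alpha>) * ((1 - 1 / \<theta>) * u powr (1 - 1 / \<theta> - 1) * (1 / \<beta>)))) (at x)"
    unfolding recip_hazard_def[abs_def] u_def
    using u assms unfolding u_def
    by (auto intro!: derivative_eq_intros)
  moreover have "\<beta> * \<theta> * (1 / \<beta> + (1 - \<alpha>) * ((1 - 1 / \<theta>) * (1 / \<alpha> * w) * (1 / \<beta>))) =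
      \<theta> + (1 / \<alpha> - 1) * (\<theta> - 1) * w" for w
    using assms by (simp add: field_simps)
  moreover have "1 - 1 / \<theta> - 1 = - (1 / \<theta>)" by simp
  ultimately show ?thesis by (simp only: v)
qed

text \<open>Weighted AM-GM for \<open>1 + r * t\<close> and \<open>1\<close> with weights
  \<open>s / r\<close> and \<open>1 - s / r\<close> bounds \<open>(1 + r * t) powr (s / r)\<close>
  by \<open>1 + s * t\<close>; raising to the power \<open>1 / s\<close> gives the claim.\<close>

lemma powr_one_plus_mult_antimono:
  fixes s r t :: real
  assumes "0 < s" "s \<le> r" "0 \<le> t"
  shows "(1 + r * t) powr (1 / r) \<le> (1 + s * t) powr (1 / s)"
proof -
  have pos: "1 + r * t > 0" using assms by (simp add: add_pos_nonneg)
  have "(1 + r * t) powr (s / r) * 1 powr (1 - s / r) \<le> s / r * (1 + r * t) + (1 - s / r) * 1"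
    using assms pos by (intro Youngs_inequality_0) auto
  also have "\<dots> = 1 + s * t" using assms by (simp add: field_simps)
  finally have "((1 + r * t) powr (s / r)) powr (1 / s) \<le> (1 + s * t) powr (1 / s)"
    using assms by (intro powr_mono2) auto
  then show ?thesis using assms by (simp add: powr_powr)
qed


theorem theorem5p7:
  fixes \<alpha> \<beta> \<theta> \<alpha>\<^sub>1 \<beta>\<^sub>1 \<theta>\<^sub>1 :: real
  assumes "\<alpha> > 0" "\<beta> > 0" "\<theta> > 0"
    and "\<alpha>\<^sub>1 > 0" "\<beta>\<^sub>1 > 0" "\<theta>\<^sub>1 > 0"
    and HR1_i: "\<beta> * \<theta> * \<alpha> powr (\<theta> - 1) \<le> \<beta>\<^sub>1 * \<theta>\<^sub>1 * \<alpha>\<^sub>1 powr (\<theta>\<^sub>1 - 1)"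
    and HR1_ii: "\<beta> * \<theta> * \<alpha> powr \<theta> \<le> \<beta>\<^sub>1 * \<theta>\<^sub>1 * \<alpha>\<^sub>1 powr \<theta>\<^sub>1"
    and HR2: "\<theta> < \<theta>\<^sub>1"
    and HR3: "(1 - \<alpha>\<^sub>1) * (\<theta>\<^sub>1 - 1) \<ge> 0"
    and HR4: "(1 / \<alpha> - 1) * (\<theta> - 1) \<le> (1 / \<alpha>\<^sub>1 - 1) * (\<theta>\<^sub>1 - 1)"
  shows "K_dist \<alpha> \<beta> \<theta> \<le>\<^sub>h\<^sub>r K_dist \<alpha>\<^sub>1 \<beta>\<^sub>1 \<theta>\<^sub>1"
proof -
  let ?g = "recip_hazard \<alpha> \<beta> \<theta>" and ?g1 = "recip_hazard \<alpha>\<^sub>1 \<beta>\<^sub>1 \<theta>\<^sub>1"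
  define C where "C = (1 / \<alpha> - 1) * (\<theta> - 1)"
  define C1 where "C1 = (1 / \<alpha>\<^sub>1 - 1) * (\<theta>\<^sub>1 - 1)"
  have "C1 = (1 - \<alpha>\<^sub>1) * (\<theta>\<^sub>1 - 1) / \<alpha>\<^sub>1"
    using assms(4) by (simp add: C1_def field_simps)
  then have C1: "C1 \<ge> 0" using HR3 assms(4) by simp
  have C: "C \<le> C1" using HR4 by (simp add: C_def C1_def)
  have slope: "\<theta> + C * (1 + x / (\<beta> * \<alpha> powr \<theta>)) powr (- (1 / \<theta>)) \<le>
      \<theta>\<^sub>1 + C1 * (1 + x / (\<beta>\<^sub>1 * \<alpha>\<^sub>1 powr \<theta>\<^sub>1)) powr (- (1 / \<theta>\<^sub>1))" (is "\<theta> + C * ?P \<le> \<theta>\<^sub>1 + C1 * ?Q")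
    if x: "x \<ge> 0" for x
  proof -
    \<comment> \<open>With this scaling the bases become \<open>1 + \<theta> * t\<close> and
      \<open>1 + \<theta>\<^sub>1 * t1\<close>, and \<open>HR1_ii\<close> says
      \<open>t1 \<le> t\<close>.\<close>
    define t where "t = x / (\<beta> * \<theta> * \<alpha> powr \<theta>)"
    define t1 where "t1 = x / (\<beta>\<^sub>1 * \<theta>\<^sub>1 * \<alpha>\<^sub>1 powr \<theta>\<^sub>1)"
    have t1: "0 \<le> t1" "t1 \<le> t"
      unfolding t_def t1_def using x assms HR1_ii by (auto intro!: divide_left_mono)
    have "(1 + \<theta>\<^sub>1 * t1) powr (1 / \<theta>\<^sub>1) \<le> (1 + \<theta>\<^sub>1 * t) powr (1 / \<theta>\<^sub>1)"
      using t1 assms by (intro powr_mono2) auto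
    also have "\<dots> \<le> (1 + \<theta> * t) powr (1 / \<theta>)"
      using t1 assms by (intro powr_one_plus_mult_antimono) auto
    finally have "inverse ((1 + \<theta> * t) powr (1 / \<theta>)) \<le> inverse ((1 + \<theta>\<^sub>1 * t1) powr (1 / \<theta>\<^sub>1))"
      using t1 assms by (intro le_imp_inverse_le) (auto simp: add_pos_nonneg add_nonneg_eq_0_iff)
    moreover have "\<theta> * t = x / (\<beta> * \<alpha> powr \<theta>)" "\<theta>\<^sub>1 * t1 = x / (\<beta>\<^sub>1 * \<alpha>\<^sub>1 powr \<theta>\<^sub>1)"
      using assms by (simp_all add: t_def t1_def)
    ultimately have PQ: "?P \<le> ?Q" by (simp add: powr_minus)
    \<comment> \<open>\<open>C\<close> may be negative, so the coefficient is raised first and the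
      power factor afterwards, when its coefficient \<open>C1\<close> is known to be
      nonnegative.\<close>
    have "C * ?P \<le> C1 * ?P" using C by (intro mult_right_mono) auto
    also have "\<dots> \<le> C1 * ?Q" using C1 PQ by (intro mult_left_mono)
    finally show ?thesis using HR2 by simp
  qed
  have le: "?g x \<le> ?g1 x" if x: "x \<ge> 0" for x
  proof -
    have "?g1 0 - ?g 0 \<le> ?g1 x - ?g x"
    proof (rule DERIV_nonneg_imp_nondecreasing[OF x])
      fix y :: real assume y: "0 \<le> y"
      show "\<exists>d. ((\<lambda>x. ?g1 x - ?g x) has_real_derivative d) (at y) \<and> d \<ge> 0"
        by (rule exI, rule conjI,
            rule DERIV_diff[OF has_real_derivative_recip_hazard[OF assms(4-6) y]
              has_real_derivative_recip_hazard[OF assms(1-3) y]])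
          (use slope[OF y] in \<open>simp add: C_def C1_def\<close>)
    qed
    moreover have "?g 0 \<le> ?g1 0"
      using HR1_i assms by (simp add: recip_hazard_0)
    ultimately show ?thesis by simp
  qed
  \<comment> \<open>Inversion of positive numbers reverses the inequality, matching the direction of
    the hazard rate order.\<close>
  show ?thesis
    unfolding hr_le_def
    using le recip_hazard_pos(1) assms
    by (auto simp: hazard_rate_eq_inverse_recip_hazard intro!: le_imp_inverse_le)
qed

end
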